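(* Let $q\ge 2$ be an integer. Given the layered equation of bounded degree, with $$h_q(x) = 1 - x + \sum_{2\le k\le q} v^{k-1} e^k f\, t_k\, x^k,$$ and the layered solution bounded by degree $$\mathbf{S}_{Lq} = \sum_{m_2,\ldots,m_q\ge 0} C[m_2,m_3,\ldots,m_q]\,(t_2 v e^2 f)^{m_2}(t_3 v^2 e^3 f)^{m_3}\cdots(t_q v^{q-1} e^q f)^{m_q},$$ where $C[m_2,\ldots,m_q]$ is the hyper-Catalan number, we have, for every integer $d\ge 0$, $$h_q(\mathbf{S}_{Lq} \bmod f^{d+1}) = 0.$$
   Context: For nonnegative integers $m_2,\ldots,m_q$, the hyper-Catalan number is $$C[m_2,m_3,\ldots,m_q] = \frac{(2m_2+3m_3+\cdots+q\,m_q)!}{(1+m_2+2m_3+\cdots+(q-1)m_q)!\; m_2!\, m_3!\cdots m_q!}.$$ It counts the ways of subdividing a planar polygon having one distinguished edge (the roof) by non-crossing diagonals into exactly $m_2$ triangles, $m_3$ quadrilaterals, ..., $m_q$ $(q+1)$-gons, with $C[0,\ldots,0]=1$. The symbols $v,e,f,t_2,\ldots,t_q$ are independent commuting formal variables, and $\mathbf{S}_{Lq}$ is a formal power series in them with integer coefficients; the exponents of $v$, $e$, $f$ record (up to constant shifts for $v$ and $e$) the numbers of vertices, edges and faces of the subdivided polygons. For such a series $a$, $a \bmod f^{d+1}$ (as a binary operation) denotes the remainder, i.e. the truncation of $a$ obtained by deleting all terms whose degree in $f$ exceeds $d$.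
   Formalization: The equation is proved modulo f^{d+1}, that is, h_q(S_Lq mod f^{d+1}) has no terms of degree at most d in f; exact vanishing as printed fails, e.g. for q = 2, d = 0 the truncation is 1 and h_2(1) = v e^2 f t_2 ≠ 0. *)

theory Defs
  imports "HOL-Library.Poly_Mapping" "HOL-Library.FuncSet"
begin

section \<open>Multivariate formal power series\<close>

text \<open>A series over the variables in \<^typ>\<open>'x\<close> is an arbitrary coefficient function on
  monomials; a monomial is a finitely supported exponent vector.\<close>

typedef (overloaded) ('x, 'a) mps = "UNIV :: (('x \<Rightarrow>\<^sub>0 nat) \<Rightarrow> 'a) set"
  morphisms mps_nth Abs_mps ..

lemma mps_nth_Abs [simp]: "mps_nth (Abs_mps c) = c"
  by (simp add: Abs_mps_inverse)

lemma mps_eqI: "(\<And>\<mu>. mps_nth a \<mu> = mps_nth b \<mu>) \<Longrightarrow> a = b"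
  by (metis mps_nth_inject ext)

definition splits :: "('x \<Rightarrow>\<^sub>0 nat) \<Rightarrow> (('x \<Rightarrow>\<^sub>0 nat) \<times> ('x \<Rightarrow>\<^sub>0 nat)) set" where
  "splits \<mu> = {(\<alpha>, \<beta>). \<alpha> + \<beta> = \<mu>}"

lemma in_splits [simp]: "(\<alpha>, \<beta>) \<in> splits \<mu> \<longleftrightarrow> \<alpha> + \<beta> = \<mu>"
  by (simp add: splits_def)

lemma finite_splits [simp]: "finite (splits (\<mu> :: 'x \<Rightarrow>\<^sub>0 nat))"
proof -
  let ?A = "{\<alpha>. \<exists>\<beta>. \<alpha> + \<beta> = \<mu>}"
  let ?G = "PiE (Poly_Mapping.keys \<mu>) (\<lambda>x. {..Poly_Mapping.lookup \<mu> x})"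
  let ?r = "\<lambda>\<alpha> :: 'x \<Rightarrow>\<^sub>0 nat. restrict (Poly_Mapping.lookup \<alpha>) (Poly_Mapping.keys \<mu>)"
  have le: "Poly_Mapping.lookup c x \<le> Poly_Mapping.lookup \<mu> x" if c: "c \<in> ?A" for c x
  proof -
    obtain b where "\<mu> = c + b" using c by blast
    then show ?thesis by (simp add: lookup_add)
  qed
  have "inj_on ?r ?A"
  proof (rule inj_onI, rule poly_mapping_eqI)
    fix a b x
    assume a: "a \<in> ?A" and b: "b \<in> ?A" and eq: "?r a = ?r b"
    show "Poly_Mapping.lookup a x = Poly_Mapping.lookup b x"
    proof (cases "x \<in> Poly_Mapping.keys \<mu>")
      case True
      moreover have "?r a x = ?r b x" using eq by simp
      ultimately show ?thesis by simp
    next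
      case False
      then have "Poly_Mapping.lookup \<mu> x = 0" by (simp add: in_keys_iff)
      then show ?thesis using le[OF a, of x] le[OF b, of x] by simp
    qed
  qed
  moreover have "?r ` ?A \<subseteq> ?G"
    using le by (auto intro!: restrict_PiE_iff[THEN iffD2])
  moreover have "finite ?G" by (intro finite_PiE) auto
  ultimately have "finite ?A" using inj_on_finite by blast
  moreover have "p \<in> (\<lambda>\<alpha>. (\<alpha>, \<mu> - \<alpha>)) ` ?A" if "p \<in> splits \<mu>" for p
  proof -
    obtain \<alpha> \<beta> where p: "p = (\<alpha>, \<beta>)" "\<alpha> + \<beta> = \<mu>"
      using \<open>p \<in> splits \<mu>\<close> by (auto simp: splits_def)
    then have "\<beta> = \<mu> - \<alpha>" using add_diff_cancel_left'[of \<alpha> \<beta>] by simp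
    with p show ?thesis by blast
  qed
  ultimately show ?thesis
    by (intro finite_subset[OF subsetI finite_imageI[of ?A "\<lambda>\<alpha>. (\<alpha>, \<mu> - \<alpha>)"]])
qed

instantiation mps :: (type, comm_ring_1) comm_ring_1
begin

definition zero_mps :: "('a, 'b) mps" where "0 = Abs_mps (\<lambda>_. 0)"
definition one_mps :: "('a, 'b) mps" where "1 = Abs_mps (\<lambda>\<mu>. if \<mu> = 0 then 1 else 0)"
definition plus_mps :: "('a, 'b) mps \<Rightarrow> ('a, 'b) mps \<Rightarrow> ('a, 'b) mps" where
  "a + b = Abs_mps (\<lambda>\<mu>. mps_nth a \<mu> + mps_nth b \<mu>)"
definition uminus_mps :: "('a, 'b) mps \<Rightarrow> ('a, 'b) mps" where
  "- a = Abs_mps (\<lambda>\<mu>. - mps_nth a \<mu>)"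
definition minus_mps :: "('a, 'b) mps \<Rightarrow> ('a, 'b) mps \<Rightarrow> ('a, 'b) mps" where
  "a - b = Abs_mps (\<lambda>\<mu>. mps_nth a \<mu> - mps_nth b \<mu>)"
definition times_mps :: "('a, 'b) mps \<Rightarrow> ('a, 'b) mps \<Rightarrow> ('a, 'b) mps" where
  "a * b = Abs_mps (\<lambda>\<mu>. \<Sum>(\<alpha>, \<beta>)\<in>splits \<mu>. mps_nth a \<alpha> * mps_nth b \<beta>)"

instance
proof
  fix a b c :: "('a, 'b) mps"
  show "a + b + c = a + (b + c)" "a + b = b + a" "0 + a = a" "- a + a = 0" "a - b = a + - b"
    by (simp_all add: plus_mps_def zero_mps_def uminus_mps_def minus_mps_def algebra_simps
        mps_nth_inverse)
  show "(0 :: ('a, 'b) mps) \<noteq> 1"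
  proof
    assume "(0 :: ('a, 'b) mps) = 1"
    then have "mps_nth (0 :: ('a, 'b) mps) 0 = mps_nth 1 0" by simp
    then show False by (simp add: zero_mps_def one_mps_def)
  qed
  show "(a + b) * c = a * c + b * c"
    by (rule mps_eqI)
      (simp add: plus_mps_def times_mps_def distrib_right sum.distrib case_prod_unfold)
  show "a * b = b * a"
    unfolding times_mps_def
    by (intro arg_cong[where f = Abs_mps] ext
        sum.reindex_bij_witness[where i = prod.swap and j = prod.swap])
      (auto simp: mult.commute add.commute)
  show "1 * a = a"
  proof (rule mps_eqI)
    fix \<mu>
    have "mps_nth (1 * a) \<mu> = (\<Sum>p\<in>splits \<mu>. if p = (0, \<mu>) then mps_nth a \<mu> else 0)"
      by (simp only: times_mps_def one_mps_def mps_nth_Abs) (rule sum.cong, auto split: if_splits)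
    then show "mps_nth (1 * a) \<mu> = mps_nth a \<mu>" by simp
  qed
  show "a * b * c = a * (b * c)"
  proof (rule mps_eqI)
    fix \<mu>
    have "mps_nth (a * b * c) \<mu> = (\<Sum>((\<gamma>, \<delta>), (\<alpha>, \<beta>))\<in>(SIGMA p:splits \<mu>. splits (fst p)).
        mps_nth a \<alpha> * mps_nth b \<beta> * mps_nth c \<delta>)"
      by (simp add: times_mps_def sum_distrib_right case_prod_unfold sum.Sigma)
    also have "\<dots> = (\<Sum>((\<alpha>, \<epsilon>), (\<beta>, \<delta>))\<in>(SIGMA p:splits \<mu>. splits (snd p)).
        mps_nth a \<alpha> * (mps_nth b \<beta> * mps_nth c \<delta>))"
      by (rule sum.reindex_bij_witness
          [where i = "\<lambda>((\<alpha>, \<epsilon>), (\<beta>, \<delta>)). ((\<alpha> + \<beta>, \<delta>), (\<alpha>, \<beta>))"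
            and j = "\<lambda>((\<gamma>, \<delta>), (\<alpha>, \<beta>)). ((\<alpha>, \<beta> + \<delta>), (\<beta>, \<delta>))"])
        (auto simp: add.assoc mult.assoc)
    also have "\<dots> = mps_nth (a * (b * c)) \<mu>"
      by (simp add: times_mps_def sum_distrib_left case_prod_unfold sum.Sigma)
    finally show "mps_nth (a * b * c) \<mu> = mps_nth (a * (b * c)) \<mu>" .
  qed
qed

end

definition mps_var :: "'x \<Rightarrow> ('x, 'a::comm_ring_1) mps" where
  "mps_var x = Abs_mps (\<lambda>\<mu>. if \<mu> = Poly_Mapping.single x 1 then 1 else 0)"

text \<open>The formal sum of a family. It is meaningful only for families in which every monomial
  occurs in finitely many members. For the family summed below this is \<open>layered_locally_finite\<close>.\<close>

definition mps_sum :: "('i \<Rightarrow> ('x, 'a::comm_ring_1) mps) \<Rightarrow> 'i set \<Rightarrow> ('x, 'a) mps" where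
  "mps_sum G I = Abs_mps (\<lambda>\<mu>. \<Sum>i | i \<in> I \<and> mps_nth (G i) \<mu> \<noteq> 0. mps_nth (G i) \<mu>)"

definition mps_locally_finite :: "('i \<Rightarrow> ('x, 'a::comm_ring_1) mps) \<Rightarrow> 'i set \<Rightarrow> bool" where
  "mps_locally_finite G I \<longleftrightarrow> (\<forall>\<mu>. finite {i \<in> I. mps_nth (G i) \<mu> \<noteq> 0})"

section \<open>Hyper-Catalan numbers and the layered series\<close>

text \<open>One fixed ring contains the variables \<open>t\<^sub>k\<close> for all \<open>k\<close>; for given \<open>q\<close> only
  \<open>t\<^sub>2, \<dots>, t\<^sub>q\<close> occur.\<close>

datatype symb = Sv | Se | Sf | St nat

type_synonym series = "(symb, int) mps"

abbreviation vv :: series where "vv \<equiv> mps_var Sv"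
abbreviation ee :: series where "ee \<equiv> mps_var Se"
abbreviation ff :: series where "ff \<equiv> mps_var Sf"
abbreviation tt :: "nat \<Rightarrow> series" where "tt k \<equiv> mps_var (St k)"

text \<open>The index tuples \<open>(m\<^sub>2, \<dots>, m\<^sub>q)\<close>, encoded as functions vanishing outside \<open>{2..q}\<close>.\<close>

definition tuples :: "nat \<Rightarrow> (nat \<Rightarrow> nat) set" where
  "tuples q = {m. \<forall>k. k \<notin> {2..q} \<longrightarrow> m k = 0}"

text \<open>The division is exact, see \<open>hyper_catalan_exact\<close> below.\<close>

definition hyper_catalan :: "nat \<Rightarrow> (nat \<Rightarrow> nat) \<Rightarrow> nat" where
  "hyper_catalan q m =
    fact (\<Sum>k=2..q. k * m k) div (fact (1 + (\<Sum>k=2..q. (k - 1) * m k)) * (\<Prod>k=2..q. fact (m k)))"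

definition layered_term :: "nat \<Rightarrow> (nat \<Rightarrow> nat) \<Rightarrow> series" where
  "layered_term q m =
    of_nat (hyper_catalan q m) * (\<Prod>k=2..q. (tt k * vv ^ (k - 1) * ee ^ k * ff) ^ m k)"

definition S_L :: "nat \<Rightarrow> series" where
  "S_L q = mps_sum (layered_term q) (tuples q)"

definition h :: "nat \<Rightarrow> series \<Rightarrow> series" where
  "h q x = 1 - x + (\<Sum>k=2..q. vv ^ (k - 1) * ee ^ k * ff * tt k * x ^ k)"

text \<open>The remainder modulo \<open>f\<^sup>n\<close>: all terms of degree at least \<open>n\<close> in \<open>f\<close> are deleted.
  A truncation of \<open>S_L q\<close> is a root of \<open>h q\<close> only up to terms of degree \<open>\<ge> n\<close> in \<open>f\<close>: for
  \<open>q = 2\<close> and \<open>n = 1\<close> it is \<open>1\<close>, and \<open>h 2 1 = v e\<^sup>2 f t\<^sub>2 \<noteq> 0\<close>.\<close>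

definition mod_f_pow :: "series \<Rightarrow> nat \<Rightarrow> series" (infixl "mod'_f'^" 70) where
  "a mod_f^ n = Abs_mps (\<lambda>\<mu>. if Poly_Mapping.lookup \<mu> Sf < n then mps_nth a \<mu> else 0)"

section \<open>Well-definedness\<close>

lemma prod_fact_dvd_fact_sum:
  assumes "finite A"
  shows "(\<Prod>x\<in>A. fact (g x)) dvd (fact (\<Sum>x\<in>A. g x) :: nat)"
  using assms
proof induction
  case (insert x A)
  have "fact (g x) * (\<Prod>x\<in>A. fact (g x)) dvd (fact (g x) * fact (\<Sum>x\<in>A. g x) :: nat)"
    using insert by (simp add: mult_dvd_mono)
  also have "\<dots> dvd fact (g x + (\<Sum>x\<in>A. g x))" by (rule fact_fact_dvd_fact)
  finally show ?case using insert by simp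
qed auto

lemma hyper_catalan_exact:
  "fact (1 + (\<Sum>k=2..q. (k - 1) * m k)) * (\<Prod>k=2..q. fact (m k)) dvd
     (fact (\<Sum>k=2..q. k * m k) :: nat)"
proof -
  define s where "s = (\<Sum>k=2..q. (k - 1) * m k)"
  define N where "N = (\<Sum>k=2..q. k * m k)"
  define D where "D = (fact (1 + s) * (\<Prod>k=2..q. fact (m k)) :: nat)"
  have N: "N = s + (\<Sum>k=2..q. m k)"
    unfolding N_def s_def sum.distrib[symmetric]
  proof (rule sum.cong)
    fix k assume "k \<in> {2..q}"
    then obtain j where "k = Suc j" by (cases k) auto
    then show "k * m k = (k - 1) * m k + m k" by simp
  qed simp
  have a: "D dvd (1 + s) * fact N"
  proof -
    have "(\<Prod>k=2..q. fact (m k)) dvd (fact (\<Sum>k=2..q. m k) :: nat)"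
      by (rule prod_fact_dvd_fact_sum) simp
    then have "fact s * (\<Prod>k=2..q. fact (m k)) dvd (fact s * fact (\<Sum>k=2..q. m k) :: nat)"
      by (simp add: mult_dvd_mono)
    also have "\<dots> dvd fact N" unfolding N by (rule fact_fact_dvd_fact)
    finally have "(1 + s) * (fact s * (\<Prod>k=2..q. fact (m k))) dvd (1 + s) * fact N"
      by (rule mult_dvd_mono[OF dvd_refl])
    moreover have "D = (1 + s) * (fact s * (\<Prod>k=2..q. fact (m k)))"
      by (simp add: D_def algebra_simps)
    ultimately show ?thesis by simp
  qed
  have b: "D dvd m j * fact N" if j: "j \<in> {2..q}" for j
  proof (cases "m j")
    case (Suc i)
    let ?m = "m(j := i)"
    have "(\<Prod>k=2..q. fact (?m k)) dvd (fact (\<Sum>k=2..q. ?m k) :: nat)"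
      by (rule prod_fact_dvd_fact_sum) simp
    then have "fact (1 + s) * (\<Prod>k=2..q. fact (?m k)) dvd
        (fact (1 + s) * fact (\<Sum>k=2..q. ?m k) :: nat)"
      by (simp only: mult_dvd_mono dvd_refl)
    also have "\<dots> dvd fact (1 + s + (\<Sum>k=2..q. ?m k))" by (rule fact_fact_dvd_fact)
    also have "1 + s + (\<Sum>k=2..q. ?m k) = N"
    proof -
      have "(\<Sum>k=2..q. ?m k) = i + (\<Sum>k\<in>{2..q} - {j}. m k)"
        using j by (subst sum.remove[of _ j]) (auto intro!: sum.cong)
      moreover have "(\<Sum>k=2..q. m k) = Suc i + (\<Sum>k\<in>{2..q} - {j}. m k)"
        using j Suc by (subst sum.remove[of _ j]) auto
      ultimately show ?thesis by (simp add: N)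
    qed
    finally have "m j * (fact (1 + s) * (\<Prod>k=2..q. fact (?m k))) dvd m j * fact N"
      by (rule mult_dvd_mono[OF dvd_refl])
    moreover have "(\<Prod>k=2..q. fact (m k) :: nat) = m j * (\<Prod>k=2..q. fact (?m k))"
    proof -
      have "(\<Prod>k=2..q. fact (?m k) :: nat) = fact i * (\<Prod>k\<in>{2..q} - {j}. fact (m k))"
        using j by (subst prod.remove[of _ j]) (auto intro!: prod.cong)
      moreover have "(\<Prod>k=2..q. fact (m k) :: nat) =
          Suc i * fact i * (\<Prod>k\<in>{2..q} - {j}. fact (m k))"
        using j Suc by (subst prod.remove[of _ j]) auto
      ultimately show ?thesis using Suc by (simp only: mult.assoc)
    qed
    ultimately show ?thesis by (simp add: D_def mult.left_commute)
  qed simp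
  have "D dvd s * fact N"
    unfolding s_def sum_distrib_right
    using b by (intro dvd_sum) (simp add: mult.assoc)
  with a have "D dvd fact N"
    by (metis add.commute dvd_add_right_iff mult.left_neutral distrib_right)
  then show ?thesis by (simp add: D_def s_def N_def)
qed

definition mps_monom :: "('x \<Rightarrow>\<^sub>0 nat) \<Rightarrow> ('x, 'a::comm_ring_1) mps" where
  "mps_monom \<nu> = Abs_mps (\<lambda>\<mu>. if \<mu> = \<nu> then 1 else 0)"

lemma mps_var_eq: "mps_var x = mps_monom (Poly_Mapping.single x 1)"
  by (simp add: mps_var_def mps_monom_def)

lemma mps_monom_0: "mps_monom 0 = 1"
  by (simp add: mps_monom_def one_mps_def)

lemma mps_monom_mult: "mps_monom a * mps_monom b = mps_monom (a + b)"
proof (rule mps_eqI)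
  fix \<mu>
  have "mps_nth (mps_monom a * mps_monom b) \<mu> =
      (\<Sum>p\<in>splits \<mu>. if p = (a, b) then (1::'b) else 0)"
    by (simp only: times_mps_def mps_monom_def mps_nth_Abs) (rule sum.cong, auto split: if_splits)
  then show "mps_nth (mps_monom a * mps_monom b :: ('a, 'b) mps) \<mu> = mps_nth (mps_monom (a + b)) \<mu>"
    by (auto simp: mps_monom_def)
qed

lemma mps_monom_power: "\<exists>b. (mps_monom a :: ('x, 'a::comm_ring_1) mps) ^ n = mps_monom b \<and>
    (\<forall>x. Poly_Mapping.lookup b x = n * Poly_Mapping.lookup a x)"
proof (induction n)
  case 0
  show ?case by (rule exI[of _ 0]) (simp add: mps_monom_0)
next
  case (Suc n)
  then obtain b where "(mps_monom a :: ('x, 'a) mps) ^ n = mps_monom b"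
    "\<forall>x. Poly_Mapping.lookup b x = n * Poly_Mapping.lookup a x" by blast
  then show ?case
    by (intro exI[of _ "a + b"]) (simp add: mps_monom_mult lookup_add)
qed

lemma mps_monom_prod: "finite A \<Longrightarrow> (\<Prod>k\<in>A. mps_monom (g k)) = mps_monom (\<Sum>k\<in>A. g k)"
  by (induction rule: finite_induct) (auto simp: mps_monom_0 mps_monom_mult)

lemma mps_nth_of_nat_mult:
  fixes a :: "('a, 'b::comm_ring_1) mps"
  shows "mps_nth (of_nat n * a) \<mu> = of_nat n * mps_nth a \<mu>"
proof (induction n)
  case 0
  have "mps_nth 0 \<mu> = (0 :: 'b)" by (simp add: zero_mps_def)
  then show ?case by simp
next
  case (Suc n)
  have "mps_nth (x + y) \<mu> = mps_nth x \<mu> + mps_nth y \<mu>" for x y :: "('a, 'b) mps"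
    by (simp add: plus_mps_def)
  with Suc show ?case by (simp add: distrib_right)
qed

lemma layered_term_monom:
  "\<exists>\<nu>. layered_term q m = of_nat (hyper_catalan q m) * mps_monom \<nu> \<and>
    (\<forall>j\<in>{2..q}. Poly_Mapping.lookup \<nu> (St j) = m j)"
proof -
  have "\<exists>\<nu>. (tt k * vv ^ (k - 1) * ee ^ k * ff) ^ m k = mps_monom \<nu> \<and>
      (\<forall>j. Poly_Mapping.lookup \<nu> (St j) = (if j = k then m k else 0))" for k
  proof -
    obtain b where b: "vv ^ (k - 1) = mps_monom b"
      "\<And>x. Poly_Mapping.lookup b x = (k - 1) * Poly_Mapping.lookup (Poly_Mapping.single Sv 1) x"
      unfolding mps_var_eq using mps_monom_power by blast
    obtain c where c: "ee ^ k = mps_monom c"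
      "\<And>x. Poly_Mapping.lookup c x = k * Poly_Mapping.lookup (Poly_Mapping.single Se 1) x"
      unfolding mps_var_eq using mps_monom_power by blast
    let ?s = "Poly_Mapping.single (St k) 1 + b + c + Poly_Mapping.single Sf 1"
    have s: "tt k * vv ^ (k - 1) * ee ^ k * ff = mps_monom ?s"
      unfolding b(1) c(1) unfolding mps_var_eq mps_monom_mult ..
    obtain d where d: "(mps_monom ?s :: series) ^ m k = mps_monom d"
      "\<And>x. Poly_Mapping.lookup d x = m k * Poly_Mapping.lookup ?s x"
      using mps_monom_power by blast
    show ?thesis
      unfolding s d(1)
      by (intro exI[of _ d]) (auto simp: d(2) lookup_add b(2) c(2) lookup_single when_def)
  qed
  then obtain g where g: "\<And>k. (tt k * vv ^ (k - 1) * ee ^ k * ff) ^ m k = mps_monom (g k)"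
    "\<And>k j. Poly_Mapping.lookup (g k) (St j) = (if j = k then m k else 0)" by metis
  have "layered_term q m = of_nat (hyper_catalan q m) * mps_monom (\<Sum>k=2..q. g k)"
    unfolding layered_term_def g(1) by (simp add: mps_monom_prod)
  then show ?thesis
    by (intro exI[of _ "\<Sum>k=2..q. g k"]) (auto simp: g(2) lookup_sum)
qed

lemma layered_locally_finite: "mps_locally_finite (layered_term q) (tuples q)"
  unfolding mps_locally_finite_def
proof
  fix \<mu>
  have "{m \<in> tuples q. mps_nth (layered_term q m) \<mu> \<noteq> 0} \<subseteq>
      {\<lambda>k. if k \<in> {2..q} then Poly_Mapping.lookup \<mu> (St k) else 0}"
  proof (clarsimp, rule ext)
    fix m k assume m: "m \<in> tuples q" "mps_nth (layered_term q m) \<mu> \<noteq> 0"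
    obtain \<nu> where \<nu>: "layered_term q m = of_nat (hyper_catalan q m) * mps_monom \<nu>"
      "\<forall>j\<in>{2..q}. Poly_Mapping.lookup \<nu> (St j) = m j"
      using layered_term_monom by blast
    with m(2) have "\<mu> = \<nu>"
      by (auto simp: mps_nth_of_nat_mult mps_monom_def split: if_splits)
    with \<nu>(2) m(1)
    show "m k = (if 2 \<le> k \<and> k \<le> q then Poly_Mapping.lookup \<mu> (St k) else 0)"
      by (auto simp: tuples_def)
  qed
  then show "finite {m \<in> tuples q. mps_nth (layered_term q m) \<mu> \<noteq> 0}"
    using finite_subset by blast
qed

end

theory Submission
  imports Defs
begin

text \<open>Write \<open>z\<^sub>k = t\<^sub>k v\<^bsup>k-1\<^esup> e\<^sup>k f\<close> and \<open>S\<close> for the layered series. The heart of the matter is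
  that \<open>S\<close> itself is a root: \<open>S = 1 + \<Sum>\<^sub>k z\<^sub>k S\<^sup>k\<close> (\<open>h_S_L\<close>). Two series that agree in \<open>f\<close>-degree
  below \<open>n\<close> have values under \<open>h q\<close> that agree there too (\<open>h_cong\<close>), because differences of equal
  powers are multiples of the difference. Truncating \<open>S\<close> therefore leaves an error of \<open>f\<close>-degree at
  least \<open>n\<close> only.

  The root property is combinatorially plain: a subdivided polygon is a bare edge, or its roof
  borders a \<open>(k+1)\<close>-gon on whose other \<open>k\<close> edges \<open>k\<close> subdivided polygons sit. The difficulty is to
  obtain it from the factorial formula, which describes \<open>S\<close> but not its powers. The powers are
  brought in by counting, for each \<open>r\<close>, the rows of \<open>r\<close> subdivided polygons. Decomposing
  the first polygon of a row of \<open>r + 1\<close> gives, for the generating series \<open>G\<^sub>r\<close>, the linear recurrence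
  \<open>G\<^bsub>r+1\<^esub> = G\<^sub>r + \<Sum>\<^sub>k z\<^sub>k G\<^bsub>r+k\<^esub>\<close> with \<open>G\<^sub>0 = 1\<close> (\<open>forest_series_Suc\<close>).

  The numbers \<open>forests q r m\<close> are defined by this recurrence, and it proves by induction the closed
  form \<open>r (r + N - 1)! / ((r + N - M)! \<Prod>\<^sub>k m\<^sub>k!)\<close> with \<open>N = \<Sum>\<^sub>k k m\<^sub>k\<close> and \<open>M = \<Sum>\<^sub>k m\<^sub>k\<close>
  (\<open>forests_closed_form\<close>). At \<open>r = 1\<close> this is the hyper-Catalan number, so \<open>G\<^sub>1 = S\<close>.

  That \<open>G\<^sub>r = S\<^sup>r\<close> needs no convolution identity for the factorials. A sequence of series that
  satisfies the recurrence is determined by its first member (\<open>forest_recurrence_unique\<close>), since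
  each \<open>z\<^sub>k\<close> raises the \<open>f\<close>-degree. For fixed \<open>s\<close> both \<open>G\<^bsub>r+s\<^esub>\<close> and \<open>G\<^sub>r G\<^sub>s\<close> satisfy it in \<open>r\<close> and
  begin with \<open>G\<^sub>s\<close>, so they are equal (\<open>forest_series_add\<close>). The recurrence at \<open>r = 0\<close> is then the
  equation for \<open>S\<close>.\<close>

section \<open>Counting forests of subdivided polygons\<close>

text \<open>The number of rows of \<open>r\<close> subdivided polygons that have \<open>m k\<close> faces with \<open>k + 1\<close> edges in total.
  In a row of \<open>r + 1\<close>, the first polygon is either a bare edge, which is dropped, or has a
  \<open>(k+1)\<close>-gon below its roof, whose removal leaves \<open>k\<close> polygons in place of one.\<close>

function forests :: "nat \<Rightarrow> nat \<Rightarrow> (nat \<Rightarrow> nat) \<Rightarrow> nat" where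
  "forests q 0 m = (if \<forall>k\<in>{2..q}. m k = 0 then 1 else 0)"
| "forests q (Suc r) m = forests q r m +
     (\<Sum>k | k \<in> {2..q} \<and> 0 < m k. forests q (r + k) (m(k := m k - 1)))"
  by pat_completeness auto

lemma sum_remove_face:
  fixes w :: "nat \<Rightarrow> nat"
  assumes "k \<in> {2..q}" "0 < m k"
  shows "(\<Sum>j=2..q. w j * m j) = w k + (\<Sum>j=2..q. w j * (m(k := m k - 1)) j)"
proof -
  have "(\<Sum>j=2..q. w j * (m(k := m k - 1)) j) = w k * (m k - 1) + (\<Sum>j\<in>{2..q} - {k}. w j * m j)"
    using assms by (subst sum.remove[of _ k]) (auto intro!: sum.cong)
  moreover have "w k * m k = w k + w k * (m k - 1)"
    using assms(2) by (cases "m k") auto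
  ultimately show ?thesis
    using assms(1) by (subst sum.remove[of _ k]) auto
qed

text \<open>Removing a face lengthens the row but lowers the number of faces, and dropping a bare edge
  shortens the row.\<close>

termination forests
proof (relation "measures [\<lambda>(q, r, m). \<Sum>k=2..q. m k, \<lambda>(q, r, m). r]", goal_cases)
  case (3 q r m k)
  then show ?case
    using sum_remove_face[of k q m "\<lambda>_. 1"] by simp
qed auto

lemma prod_fact_remove_face:
  fixes m :: "nat \<Rightarrow> nat"
  assumes "k \<in> {2..q}" "0 < m k"
  shows "(\<Prod>j=2..q. fact (m j) :: nat) = m k * (\<Prod>j=2..q. fact ((m(k := m k - 1)) j))"
proof -
  have "(\<Prod>j=2..q. fact ((m(k := m k - 1)) j) :: nat) =
      fact (m k - 1) * (\<Prod>j\<in>{2..q} - {k}. fact (m j))"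
    using assms by (subst prod.remove[of _ k]) (auto intro!: prod.cong)
  moreover have "(fact (m k) :: nat) = m k * fact (m k - 1)"
    using assms(2) by (simp add: fact_reduce)
  ultimately show ?thesis
    using assms(1) by (subst prod.remove[of _ k]) auto
qed

lemma sum_edges_eq:
  "(\<Sum>k=2..q. k * m k) = (\<Sum>k=2..q. (k - 1) * m k) + (\<Sum>k=2..q. m k :: nat)"
  unfolding sum.distrib[symmetric]
proof (rule sum.cong)
  fix k assume "k \<in> {2..q}"
  then obtain j where "k = Suc j" by (cases k) auto
  then show "k * m k = (k - 1) * m k + m k" by simp
qed simp

lemma forests_no_faces: "\<forall>k\<in>{2..q}. m k = 0 \<Longrightarrow> forests q r m = 1"
proof (induction r)
  case (Suc r)
  then have "{k. k \<in> {2..q} \<and> 0 < m k} = {}" by auto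
  with Suc show ?case by (simp only: forests.simps) simp
qed simp

text \<open>With \<open>N = \<Sum>\<^sub>k k m\<^sub>k\<close>, \<open>M = \<Sum>\<^sub>k m\<^sub>k\<close> and \<open>P = r + N - M\<close>, every summand of the recurrence
  for \<open>r + 1\<close>, multiplied by \<open>(P + 1)! \<Prod>\<^sub>k m\<^sub>k!\<close>, is a multiple of \<open>(r + N - 1)!\<close>: the bare edge
  contributes the factor \<open>(P + 1) r\<close> and the \<open>(k+1)\<close>-gon the factor \<open>m\<^sub>k (r + k)\<close>. They add up to
  \<open>(P + 1) r + r M + N = (r + 1) (r + N)\<close>. The assumption excludes the empty row without faces,
  which is counted once while the right-hand side vanishes.\<close>

lemma forests_closed_form:
  assumes "0 < r \<or> (\<exists>k\<in>{2..q}. 0 < m k)"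
  shows "forests q r m * (fact (r + (\<Sum>k=2..q. (k - 1) * m k)) * (\<Prod>k=2..q. fact (m k))) =
    r * fact (r + (\<Sum>k=2..q. k * m k) - 1)"
  using assms
proof (induction q r m rule: forests.induct)
  case (1 q m)
  then show ?case by auto
next
  case (2 q r m)
  define N where "N = (\<Sum>k=2..q. k * m k)"
  define P where "P = r + (\<Sum>k=2..q. (k - 1) * m k)"
  define M where "M = (\<Sum>k=2..q. m k)"
  define F where "F = (\<Prod>k=2..q. fact (m k) :: nat)"
  let ?K = "{k. k \<in> {2..q} \<and> 0 < m k}"
  have PM: "P + M = r + N"
    by (simp add: P_def M_def N_def sum_edges_eq)
  show ?case
  proof (cases "r = 0 \<and> (\<forall>k\<in>{2..q}. m k = 0)")
    case True
    \<comment> \<open>The recurrence refers to the excluded empty row, so the induction hypothesis is of no help.\<close>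
    then have "forests q (Suc r) m = 1" by (intro forests_no_faces) simp
    with True show ?thesis by simp
  next
    case False
    then have pos: "0 < r \<or> (\<exists>k\<in>{2..q}. 0 < m k)" by auto
    have "0 < r + N"
    proof (cases "r = 0")
      case True
      with pos obtain k where "k \<in> {2..q}" "0 < m k" by auto
      then show ?thesis
        using sum_remove_face[of k q m "\<lambda>k. k"] by (simp add: N_def)
    qed simp
    then obtain n where n: "r + N = Suc n" by (cases "r + N") auto
    have bare_edge: "forests q r m * (fact (Suc P) * F) = Suc P * (r * fact n)"
      proof -
      have "forests q r m * (fact P * F) = r * fact n"
        using "2.IH"(1)[OF pos] unfolding N_def[symmetric] P_def[symmetric] F_def[symmetric] n
        by simp
      then show ?thesis
        unfolding fact_Suc of_nat_id by (metis (no_types, lifting) mult.assoc mult.left_commute)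
    qed
    have face: "forests q (r + k) (m(k := m k - 1)) * (fact (Suc P) * F) = m k * (r + k) * fact n"
      if k: "k \<in> ?K" for k
    proof -
      let ?m = "m(k := m k - 1)"
      \<comment> \<open>Replacing \<open>r\<close> by \<open>r + k\<close> makes up for the \<open>k\<close> sides of the removed face, so
        the factorial on the right-hand side is the same for all \<open>k\<close>.\<close>
      have "N = k + (\<Sum>j=2..q. j * ?m j)"
        unfolding N_def using k by (intro sum_remove_face) auto
      then have e1: "r + k + (\<Sum>j=2..q. j * ?m j) - 1 = n"
        using n by linarith
      have "(\<Sum>j=2..q. (j - 1) * m j) = (k - 1) + (\<Sum>j=2..q. (j - 1) * ?m j)"
        using k by (intro sum_remove_face) auto
      moreover have "1 \<le> k" using k by simp
      ultimately have e2: "r + k + (\<Sum>j=2..q. (j - 1) * ?m j) = Suc P"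
        unfolding P_def by linarith
      have e3: "F = m k * (\<Prod>j=2..q. fact (?m j))"
        unfolding F_def using k by (intro prod_fact_remove_face) auto
      have "0 < r + k \<or> (\<exists>j\<in>{2..q}. 0 < ?m j)" using k by auto
      then have "forests q (r + k) ?m * (fact (Suc P) * (\<Prod>j=2..q. fact (?m j))) = (r + k) * fact n"
        using "2.IH"(2)[OF k] unfolding e1 e2 by blast
      then show ?thesis
        unfolding e3 by (metis (no_types, lifting) mult.assoc mult.left_commute)
    qed
    have "(\<Sum>k\<in>?K. m k * (r + k)) = (\<Sum>k=2..q. m k * (r + k))"
      by (rule sum.mono_neutral_left) auto
    also have "\<dots> = r * M + N"
      by (simp add: M_def N_def sum_distrib_left sum.distrib[symmetric] algebra_simps)
    finally have faces: "(\<Sum>k\<in>?K. m k * (r + k)) = r * M + N" .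
    have "forests q (Suc r) m * (fact (Suc P) * F) =
        Suc P * (r * fact n) + (\<Sum>k\<in>?K. m k * (r + k) * fact n)"
      unfolding forests.simps distrib_right bare_edge sum_distrib_right
      using face by simp
    also have "\<dots> = (Suc P * r + (r * M + N)) * fact n"
      unfolding faces[symmetric] sum_distrib_right distrib_right by (simp add: algebra_simps)
    also have "Suc P * r + (r * M + N) = Suc r * Suc n"
    proof -
      have "Suc P * r + (r * M + N) = r * (P + M) + r + N" by (simp add: algebra_simps)
      also have "\<dots> = Suc r * Suc n" unfolding PM using n by (simp add: algebra_simps)
      finally show ?thesis .
    qed
    also have "Suc r * Suc n * fact n = Suc r * (fact (Suc r + N - 1) :: nat)"
    proof -
      have "Suc r + N - 1 = Suc n" using n by simp
      then show ?thesis by (simp only: fact_Suc of_nat_id mult.assoc)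
    qed
    finally show ?thesis
      by (simp add: P_def F_def N_def)
  qed
qed

lemma forests_1_eq_hyper_catalan: "forests q 1 m = hyper_catalan q m"
proof -
  have "0 < fact (1 + (\<Sum>k=2..q. (k - 1) * m k)) * (\<Prod>k=2..q. fact (m k) :: nat)"
    by (simp add: prod_pos)
  moreover have "forests q 1 m * (fact (1 + (\<Sum>k=2..q. (k - 1) * m k)) * (\<Prod>k=2..q. fact (m k)))
      = fact (\<Sum>k=2..q. k * m k)"
    using forests_closed_form[of 1 q m] by simp
  ultimately show ?thesis
    unfolding hyper_catalan_def by (metis nonzero_mult_div_cancel_right less_numeral_extra(3))
qed

section \<open>Coefficients of multivariate power series\<close>

lemma mps_nth_monom_mult:
  fixes a :: "('x, 'a::comm_ring_1) mps"
  shows "mps_nth (mps_monom \<nu> * a) (\<nu> + \<mu>) = mps_nth a \<mu>"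
proof -
  have "mps_nth (mps_monom \<nu> * a) (\<nu> + \<mu>) =
      (\<Sum>p\<in>splits (\<nu> + \<mu>). if p = (\<nu>, \<mu>) then mps_nth a \<mu> else 0)"
    by (simp only: times_mps_def mps_monom_def mps_nth_Abs) (rule sum.cong, auto split: if_splits)
  then show ?thesis by simp
qed

lemma mps_nth_monom_mult_0:
  fixes a :: "('x, 'a::comm_ring_1) mps"
  assumes "\<And>\<beta>. mps_nth a \<beta> \<noteq> 0 \<Longrightarrow> \<mu> \<noteq> \<nu> + \<beta>"
  shows "mps_nth (mps_monom \<nu> * a) \<mu> = 0"
proof -
  have "mps_nth a \<beta> = 0" if "\<nu> + \<beta> = \<mu>" for \<beta>
    using assms that by blast
  then show ?thesis
    unfolding times_mps_def mps_monom_def mps_nth_Abs by (intro sum.neutral) auto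
qed

lemma mps_nth_add: "mps_nth (a + b) \<mu> = mps_nth a \<mu> + mps_nth b \<mu>"
  by (simp add: plus_mps_def)

lemma mps_nth_diff: "mps_nth (a - b) \<mu> = mps_nth a \<mu> - mps_nth b \<mu>"
  by (simp add: minus_mps_def)

lemma mps_nth_zero: "mps_nth 0 \<mu> = 0"
  by (simp add: zero_mps_def)

lemma mps_nth_sum: "mps_nth (\<Sum>i\<in>A. g i) \<mu> = (\<Sum>i\<in>A. mps_nth (g i) \<mu>)"
  by (induction A rule: infinite_finite_induct) (simp_all add: mps_nth_add mps_nth_zero)

section \<open>The series counting forests\<close>

abbreviation zz :: "nat \<Rightarrow> series" where
  "zz k \<equiv> tt k * vv ^ (k - 1) * ee ^ k * ff"

definition forest_series :: "nat \<Rightarrow> nat \<Rightarrow> series" where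
  "forest_series q r =
    mps_sum (\<lambda>m. of_nat (forests q r m) * (\<Prod>k=2..q. zz k ^ m k)) (tuples q)"

lemma S_L_eq_forest_series: "S_L q = forest_series q 1"
  unfolding S_L_def forest_series_def layered_term_def forests_1_eq_hyper_catalan ..

text \<open>The exponent vector of \<open>z\<^sub>k\<close>.\<close>

definition face_exp :: "nat \<Rightarrow> symb \<Rightarrow>\<^sub>0 nat" where
  "face_exp k = Poly_Mapping.single (St k) 1 + Poly_Mapping.single Sv (k - 1) +
    Poly_Mapping.single Se k + Poly_Mapping.single Sf 1"

definition faces_exp :: "nat \<Rightarrow> (nat \<Rightarrow> nat) \<Rightarrow> symb \<Rightarrow>\<^sub>0 nat" where
  "faces_exp q m = (\<Sum>k=2..q. \<Sum>i<m k. face_exp k)"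

lemma mps_var_power: "mps_var x ^ n = mps_monom (Poly_Mapping.single x n)"
  by (induction n)
    (simp_all add: mps_monom_0 mps_var_eq mps_monom_mult single_add[symmetric])

lemma zz_eq_monom: "zz k = mps_monom (face_exp k)"
  unfolding mps_var_power unfolding mps_var_eq mps_monom_mult face_exp_def ..

lemma prod_zz_eq_monom: "(\<Prod>k=2..q. zz k ^ m k) = mps_monom (faces_exp q m)"
proof -
  have power: "(mps_monom \<nu> :: series) ^ n = mps_monom (\<Sum>i<n. \<nu>)" for \<nu> n
    by (induction n) (simp_all add: mps_monom_0 mps_monom_mult add.commute)
  show ?thesis
    by (simp only: zz_eq_monom power mps_monom_prod finite_atLeastAtMost faces_exp_def)
qed

lemma lookup_faces_exp_St:
  "Poly_Mapping.lookup (faces_exp q m) (St j) = (if j \<in> {2..q} then m j else 0)"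
proof -
  have "Poly_Mapping.lookup (face_exp k) (St j) = (if k = j then 1 else 0)" for k
    by (simp add: face_exp_def lookup_add lookup_single when_def)
  then have "Poly_Mapping.lookup (faces_exp q m) (St j) =
      (\<Sum>k=2..q. if k = j then m k else 0)"
    unfolding faces_exp_def lookup_sum by (intro sum.cong) auto
  then show ?thesis by simp
qed

text \<open>The exponents of the \<open>t\<^sub>k\<close> recover the tuple, so distinct tuples contribute to distinct
  monomials and the coefficients of the forest series are single forest numbers.\<close>

lemma faces_exp_inj:
  assumes "m \<in> tuples q" "m' \<in> tuples q" "faces_exp q m = faces_exp q m'"
  shows "m = m'"
proof
  fix k show "m k = m' k"
    using assms lookup_faces_exp_St[of q m k] lookup_faces_exp_St[of q m' k]
    by (auto simp: tuples_def split: if_splits)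
qed

lemma faces_exp_remove_face:
  assumes "k \<in> {2..q}" "0 < m k"
  shows "faces_exp q m = face_exp k + faces_exp q (m(k := m k - 1))"
proof -
  obtain n where n: "m k = Suc n" using assms(2) by (cases "m k") auto
  have "faces_exp q (m(k := m k - 1)) =
      (\<Sum>i<n. face_exp k) + (\<Sum>j\<in>{2..q} - {k}. \<Sum>i<m j. face_exp j)"
    unfolding faces_exp_def
    using assms n by (subst sum.remove[of _ k]) (auto intro!: sum.cong)
  moreover have "faces_exp q m =
      (\<Sum>i<Suc n. face_exp k) + (\<Sum>j\<in>{2..q} - {k}. \<Sum>i<m j. face_exp j)"
    unfolding faces_exp_def
    using assms n by (subst sum.remove[of _ k]) auto
  ultimately show ?thesis by (simp add: ac_simps)
qed

lemma faces_exp_no_faces: "\<forall>k\<in>{2..q}. m k = 0 \<Longrightarrow> faces_exp q m = 0"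
  by (simp add: faces_exp_def)

lemma mps_nth_forest_term:
  "mps_nth (of_nat (forests q r m) * (\<Prod>k=2..q. zz k ^ m k)) \<mu> =
    (if \<mu> = faces_exp q m then int (forests q r m) else 0)"
  unfolding prod_zz_eq_monom by (simp add: mps_nth_of_nat_mult mps_monom_def)

lemma mps_nth_forest_series:
  assumes "m \<in> tuples q"
  shows "mps_nth (forest_series q r) (faces_exp q m) = int (forests q r m)"
proof -
  have "{i \<in> tuples q. (if faces_exp q m = faces_exp q i then int (forests q r i) else 0) \<noteq> 0}
      = (if forests q r m = 0 then {} else {m})"
    using assms faces_exp_inj by (auto split: if_splits)
  then show ?thesis
    unfolding forest_series_def mps_sum_def mps_nth_Abs mps_nth_forest_term by auto
qed

lemma mps_nth_forest_series_0:
  assumes "\<mu> \<notin> faces_exp q ` tuples q"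
  shows "mps_nth (forest_series q r) \<mu> = 0"
proof -
  have "{i \<in> tuples q. mps_nth (of_nat (forests q r i) * (\<Prod>k=2..q. zz k ^ i k)) \<mu> \<noteq> 0} = {}"
    unfolding mps_nth_forest_term using assms by auto
  then show ?thesis
    unfolding forest_series_def mps_sum_def mps_nth_Abs by (simp only: sum.empty)
qed

lemma forest_series_0: "forest_series q 0 = 1"
proof (rule mps_eqI)
  fix \<mu>
  show "mps_nth (forest_series q 0) \<mu> = mps_nth 1 \<mu>"
  proof (cases "\<mu> \<in> faces_exp q ` tuples q")
    case True
    then obtain m where m: "m \<in> tuples q" "\<mu> = faces_exp q m" by auto
    have "\<mu> = 0 \<longleftrightarrow> (\<forall>k\<in>{2..q}. m k = 0)"
      using m(2) faces_exp_no_faces lookup_faces_exp_St[of q m] by (metis lookup_zero)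
    then show ?thesis
      unfolding m(2) mps_nth_forest_series[OF m(1)] by (simp add: one_mps_def)
  next
    case False
    have "0 = faces_exp q (\<lambda>_. 0)" by (simp add: faces_exp_no_faces)
    moreover have "(\<lambda>_. 0) \<in> tuples q" by (simp add: tuples_def)
    ultimately have "\<mu> \<noteq> 0" using False by blast
    then show ?thesis using mps_nth_forest_series_0[OF False] by (simp add: one_mps_def)
  qed
qed

lemma mps_nth_zz_mult_forest_series:
  assumes "m \<in> tuples q" "k \<in> {2..q}"
  shows "mps_nth (zz k * forest_series q s) (faces_exp q m) =
    (if 0 < m k then int (forests q s (m(k := m k - 1))) else 0)"
proof (cases "0 < m k")
  case True
  have "m(k := m k - 1) \<in> tuples q" using assms by (auto simp: tuples_def)
  then show ?thesis
    using True assms(2)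
    by (simp only: zz_eq_monom faces_exp_remove_face[of k q m] mps_nth_monom_mult
        mps_nth_forest_series if_True)
next
  case False
  have "faces_exp q m \<noteq> face_exp k + \<beta>" for \<beta>
  proof
    assume "faces_exp q m = face_exp k + \<beta>"
    then have "Poly_Mapping.lookup (faces_exp q m) (St k) =
        Poly_Mapping.lookup (face_exp k) (St k) + Poly_Mapping.lookup \<beta> (St k)"
      by (simp add: lookup_add)
    then show False
      using False assms(2)
      by (simp add: lookup_faces_exp_St face_exp_def lookup_add lookup_single)
  qed
  then have "mps_nth (mps_monom (face_exp k) * forest_series q s) (faces_exp q m) = 0"
    by (intro mps_nth_monom_mult_0)
  with False show ?thesis by (simp only: zz_eq_monom if_False)
qed

text \<open>Multiplication by \<open>z\<^sub>k\<close> shifts the tuple by one face, so on monomials that belong to a tuple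
  this is the recurrence of the forest numbers. All other monomials have coefficient zero on both
  sides, as adding a face to a tuple gives a tuple.\<close>

lemma forest_series_Suc:
  "forest_series q (Suc r) =
    forest_series q r + (\<Sum>k=2..q. zz k * forest_series q (r + k))"
proof (rule mps_eqI)
  fix \<mu>
  show "mps_nth (forest_series q (Suc r)) \<mu> =
    mps_nth (forest_series q r + (\<Sum>k=2..q. zz k * forest_series q (r + k))) \<mu>"
  proof (cases "\<mu> \<in> faces_exp q ` tuples q")
    case True
    then obtain m where m: "m \<in> tuples q" "\<mu> = faces_exp q m" by auto
    have "(\<Sum>k=2..q. mps_nth (zz k * forest_series q (r + k)) \<mu>) =
        (\<Sum>k=2..q. if 0 < m k then int (forests q (r + k) (m(k := m k - 1))) else 0)"
      unfolding m(2) by (intro sum.cong mps_nth_zz_mult_forest_series m(1)) auto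
    also have "\<dots> = (\<Sum>k | k \<in> {2..q} \<and> 0 < m k. int (forests q (r + k) (m(k := m k - 1))))"
      by (intro sum.mono_neutral_cong_right) auto
    finally show ?thesis
      by (simp only: mps_nth_add mps_nth_sum) (simp add: m mps_nth_forest_series)
  next
    case False
    have "mps_nth (zz k * forest_series q (r + k)) \<mu> = 0" if k: "k \<in> {2..q}" for k
      unfolding zz_eq_monom
    proof (rule mps_nth_monom_mult_0)
      fix \<beta>
      assume "mps_nth (forest_series q (r + k)) \<beta> \<noteq> 0"
      then obtain m where m: "m \<in> tuples q" "\<beta> = faces_exp q m"
        using mps_nth_forest_series_0 by blast
      let ?m = "m(k := Suc (m k))"
      have "?m \<in> tuples q" using m(1) k by (auto simp: tuples_def)
      moreover have "faces_exp q ?m = face_exp k + \<beta>"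
        using faces_exp_remove_face[of k q ?m] k m(2) by simp
      ultimately show "\<mu> \<noteq> face_exp k + \<beta>" using False by (metis imageI)
    qed
    then show ?thesis
      using mps_nth_forest_series_0[OF False]
      by (simp only: mps_nth_add mps_nth_sum) simp
  qed
qed

section \<open>Congruence modulo powers of f\<close>

text \<open>Divisibility by \<open>f\<^sup>n\<close>, read off the coefficients instead of through a quotient: this
  form is the one that truncation speaks of, and its closure under sums and multiples is
  immediate.\<close>

definition f_divides :: "nat \<Rightarrow> series \<Rightarrow> bool" where
  "f_divides n a \<longleftrightarrow> (\<forall>\<mu>. Poly_Mapping.lookup \<mu> Sf < n \<longrightarrow> mps_nth a \<mu> = 0)"

lemma mod_f_pow_eq_0_iff: "a mod_f^ n = 0 \<longleftrightarrow> f_divides n a"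
proof
  assume "a mod_f^ n = 0"
  then have "mps_nth (a mod_f^ n) \<mu> = 0" for \<mu> by (simp add: mps_nth_zero)
  then show "f_divides n a"
    unfolding mod_f_pow_def f_divides_def mps_nth_Abs by metis
next
  assume "f_divides n a"
  then show "a mod_f^ n = 0"
    by (intro mps_eqI) (simp add: mod_f_pow_def f_divides_def mps_nth_zero)
qed

lemma f_divides_add: "f_divides n a \<Longrightarrow> f_divides n b \<Longrightarrow> f_divides n (a + b)"
  by (simp add: f_divides_def mps_nth_add)

lemma f_divides_diff: "f_divides n a \<Longrightarrow> f_divides n b \<Longrightarrow> f_divides n (a - b)"
  by (simp add: f_divides_def mps_nth_diff)

lemma f_divides_sum: "(\<And>i. i \<in> A \<Longrightarrow> f_divides n (g i)) \<Longrightarrow> f_divides n (\<Sum>i\<in>A. g i)"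
  by (simp add: f_divides_def mps_nth_sum)

lemma f_divides_mult:
  assumes "f_divides i a" "f_divides n b"
  shows "f_divides (i + n) (a * b)"
  unfolding f_divides_def
proof (intro allI impI)
  fix \<mu> :: "symb \<Rightarrow>\<^sub>0 nat"
  assume "Poly_Mapping.lookup \<mu> Sf < i + n"
  then have "Poly_Mapping.lookup \<alpha> Sf < i \<or> Poly_Mapping.lookup \<beta> Sf < n"
    if "\<alpha> + \<beta> = \<mu>" for \<alpha> \<beta>
    using that by (auto simp: lookup_add)
  then have "mps_nth a \<alpha> * mps_nth b \<beta> = 0" if "\<alpha> + \<beta> = \<mu>" for \<alpha> \<beta>
    using that assms by (auto simp: f_divides_def)
  then show "mps_nth (a * b) \<mu> = 0"
    unfolding times_mps_def mps_nth_Abs by (intro sum.neutral) auto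
qed

lemma f_divides_0: "f_divides 0 a"
  by (simp add: f_divides_def)

lemma f_divides_mult_left: "f_divides n b \<Longrightarrow> f_divides n (a * b)"
  using f_divides_mult[OF f_divides_0] by simp

lemma f_divides_zz: "f_divides 1 (zz k)"
  unfolding zz_eq_monom
  by (auto simp: f_divides_def mps_monom_def face_exp_def lookup_add lookup_single)

lemma f_divides_all_imp_0: "(\<And>n. f_divides n a) \<Longrightarrow> a = 0"
  by (intro mps_eqI) (auto simp: f_divides_def mps_nth_zero)

lemma f_divides_diff_mod: "f_divides n (a - a mod_f^ n)"
  by (simp add: f_divides_def mps_nth_diff mod_f_pow_def)

text \<open>\<open>x - y\<close> divides \<open>x\<^sup>k - y\<^sup>k\<close>, hence it divides \<open>h q x - h q y\<close>.\<close>

lemma h_cong: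
  assumes "f_divides n (x - y)"
  shows "f_divides n (h q x - h q y)"
proof -
  have "f_divides n (x ^ k - y ^ k)" for k
    unfolding power_diff_sumr2 by (subst mult.commute) (rule f_divides_mult_left[OF assms])
  then have "f_divides n ((\<Sum>k=2..q. vv ^ (k - 1) * ee ^ k * ff * tt k * (x ^ k - y ^ k)) - (x - y))"
    by (rule f_divides_diff[OF f_divides_sum[OF f_divides_mult_left] assms])
  moreover have "h q x - h q y =
      (\<Sum>k=2..q. vv ^ (k - 1) * ee ^ k * ff * tt k * (x ^ k - y ^ k)) - (x - y)"
    unfolding h_def right_diff_distrib sum_subtractf by simp
  ultimately show ?thesis by simp
qed

section \<open>The functional equation\<close>

text \<open>If all members are divisible by \<open>f\<^sup>n\<close>, then the sum in the recurrence is divisible by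
  \<open>f\<^bsup>n+1\<^esup>\<close>, so modulo \<open>f\<^bsup>n+1\<^esup>\<close> the sequence is constant and equal to its first member, zero. Thus
  all members are divisible by every power of \<open>f\<close>. Stated for the first member zero, the lemma is
  applied to differences of solutions.\<close>

lemma forest_recurrence_unique:
  fixes a :: "nat \<Rightarrow> series"
  assumes rec: "\<And>r. a (Suc r) = a r + (\<Sum>k=2..q. zz k * a (r + k))"
    and zero: "a 0 = 0"
  shows "a r = 0"
proof -
  have "f_divides n (a r)" for n r
  proof (induction n arbitrary: r)
    case 0
    show ?case by (rule f_divides_0)
  next
    case (Suc n)
    note IH = Suc.IH
    show ?case
    proof (induction r)
      case 0
      show ?case by (simp add: zero f_divides_def mps_nth_zero)
    next
      case (Suc r)
      have "f_divides (Suc n) (zz k * a (r + k))" for k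
        using f_divides_mult[OF f_divides_zz IH, of k "r + k"] by (simp only: plus_1_eq_Suc)
      then show ?case
        unfolding rec[of r] by (intro f_divides_add f_divides_sum Suc.IH)
    qed
  qed
  then show ?thesis by (rule f_divides_all_imp_0)
qed

text \<open>The recurrence is linear, so it survives multiplication by the fixed series
  \<open>forest_series q s\<close> as well as the shift of the index by \<open>s\<close>.\<close>

lemma forest_series_add: "forest_series q (r + s) = forest_series q r * forest_series q s"
proof -
  let ?a = "\<lambda>r. forest_series q (r + s) - forest_series q r * forest_series q s"
  have "?a r = 0"
  proof (rule forest_recurrence_unique[of ?a q])
    show "?a 0 = 0" by (simp add: forest_series_0)
    fix r
    have "forest_series q (Suc r + s) =
        forest_series q (r + s) + (\<Sum>k=2..q. zz k * forest_series q (r + k + s))"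
      using forest_series_Suc[of q "r + s"] by (simp only: add_Suc add.assoc add.commute[of s])
    then show "?a (Suc r) = ?a r + (\<Sum>k=2..q. zz k * ?a (r + k))"
      unfolding forest_series_Suc[of q r] right_diff_distrib sum_subtractf distrib_right
        sum_distrib_right by (simp add: mult.assoc)
  qed
  then show ?thesis by simp
qed

lemma forest_series_eq_power: "forest_series q r = S_L q ^ r"
proof (induction r)
  case 0
  show ?case by (simp add: forest_series_0)
next
  case (Suc r)
  then show ?case
    using forest_series_add[of q 1 r] by (simp add: S_L_eq_forest_series)
qed

text \<open>A single polygon is a bare edge or is decomposed at its roof: the recurrence at \<open>r = 0\<close>.\<close>

lemma h_S_L: "h q (S_L q) = 0"
proof -
  have "S_L q = 1 + (\<Sum>k=2..q. zz k * S_L q ^ k)"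
    using forest_series_Suc[of q 0] by (simp add: forest_series_eq_power)
  also have "(\<Sum>k=2..q. zz k * S_L q ^ k) =
      (\<Sum>k=2..q. vv ^ (k - 1) * ee ^ k * ff * tt k * S_L q ^ k)" (is "_ = ?X")
    by (intro sum.cong) (simp_all add: ac_simps)
  finally have "1 + ?X - S_L q = 0" by (metis right_minus_eq)
  then show ?thesis
    unfolding h_def by (simp only: diff_add_eq)
qed

theorem theorem5:
  fixes q d :: nat
  assumes "q \<ge> 2"
  shows "h q (S_L q mod_f^ (d + 1)) mod_f^ (d + 1) = 0"
proof -
  have "f_divides (d + 1) (h q (S_L q) - h q (S_L q mod_f^ (d + 1)))"
    by (intro h_cong f_divides_diff_mod)
  then show ?thesis
    unfolding mod_f_pow_eq_0_iff h_S_L f_divides_def mps_nth_diff mps_nth_zero by simp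
qed

end
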